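(* Let $\Phi:\mathbb{R}^N\to\mathbb{R}$ satisfy $\inf_x\Phi(x)>-\infty$, and let Algorithm B be a basic algorithm for minimizing $\Phi$ such that there exist constants $\nu>0$ and $\beta>0$ for which, whenever $y$ is generated from $x$ by one step of Algorithm B, $$\Phi(y)\le\Phi(x)-\nu\|y-x\|_2^2\quad\text{and}\quad \mathrm{dist}(\mathbf{0},\partial\Phi(y))\le\beta\|y-x\|_2 .$$ Suppose that $\Phi$ is a KL function and has a Lipschitz gradient with constant $L_\Phi\ge 0$, i.e. $\Phi$ is differentiable with $\|\nabla\Phi(x)-\nabla\Phi(y)\|_2\le L_\Phi\|x-y\|_2$ for all $x,y\in\mathbb{R}^N$. Let $\{x^k\}_{k=0,1,2,\ldots}$ be generated by Algorithm B with line search (as defined in the context) and suppose that it is bounded. Then the whole sequence $\{x^k\}$ converges to a critical point of $\Phi$, i.e. to a point $x^*$ with $\mathbf{0}\in\partial\Phi(x^* )$.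
   Context: A basic algorithm ("Algorithm B") is an update rule which, from a point $x\in\mathbb{R}^N$, generates a next point $y\in\mathbb{R}^N$ (possibly chosen among several admissible ones). Algorithm B with line search: fix parameters $\alpha>0$, $0<\eta<1$, $M\in\mathbb{N}$ and an initial point $x^0\in\mathbb{R}^N$. For $k=0,1,2,\ldots$: (1) use $x^k$ to generate $y^k$ by one step of Algorithm B and set $d^k=y^k-x^k$; (2) let $m_k$ be the smallest positive integer $m$ such that $\Phi(y^k+\eta^m d^k)\le\Phi(y^k)-\alpha\eta^m\|d^k\|_2^2$ (with $m_k=+\infty$ if there is none); (3) set $\eta_k=\eta^{m_k}$ if $m_k\le M$ and $\eta_k=0$ if $m_k>M$; (4) set $x^{k+1}=x^k+(\eta_k+1)d^k$. Subdifferentials: for a proper lower semicontinuous $J:\mathbb{R}^N\to(-\infty,+\infty]$ and $x$ with $J(x)<+\infty$, the Fréchet subdifferential $\hat\partial J(x)$ is the set of $u\in\mathbb{R}^N$ with $\liminf_{y\to x,\,y\ne x}\frac{J(y)-J(x)-\langle u,y-x\rangle}{\|y-x\|_2}\ge 0$ (and $\hat\partial J(x)=\emptyset$ if $J(x)=+\infty$). The (limiting) subdifferential is $\partial J(x)=\{u:\exists\, x^k\to x,\ J(x^k)\to J(x),\ u^k\in\hat\partial J(x^k),\ u^k\to u\}$. $\mathrm{dist}(\mathbf 0,S)=\inf_{s\in S}\|s\|_2$, with value $+\infty$ if $S=\emptyset$. (For continuously differentiable $\Phi$, $\partial\Phi(x)=\{\nabla\Phi(x)\}$.) KL functions: $J$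 has the Kurdyka-Łojasiewicz property at $\overline{x}\in\mathrm{dom}(\partial J)=\{x:\partial J(x)\neq\emptyset\}$ if there exist $\zeta\in(0,+\infty]$, a neighborhood $U$ of $\overline{x}$ and a continuous function $\varphi:[0,\zeta)\to\mathbb{R}^+=[0,+\infty)$ such that $\varphi(0)=0$; $\varphi$ is $C^1$ on $(0,\zeta)$; $\varphi'(s)>0$ for all $s\in(0,\zeta)$; and for all $x\in U$ with $J(\overline{x})<J(x)<J(\overline{x})+\zeta$, $\varphi'(J(x)-J(\overline{x}))\,\mathrm{dist}(\mathbf{0},\partial J(x))\ge 1$. A proper lower semicontinuous function having this property at each point of $\mathrm{dom}(\partial J)$ is called a KL function. *)

theory Defs
  imports "HOL-Analysis.Analysis"
begin

section \<open>Subdifferentials of extended-real-valued functions\<close>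

definition proper_fun :: "('a \<Rightarrow> ereal) \<Rightarrow> bool" where
  "proper_fun J \<longleftrightarrow> (\<forall>x. J x > -\<infinity>) \<and> (\<exists>x. J x < \<infinity>)"

definition lower_semicont :: "('a::topological_space \<Rightarrow> ereal) \<Rightarrow> bool" where
  "lower_semicont J \<longleftrightarrow> (\<forall>x. J x \<le> Liminf (at x) J)"

definition frechet_subdiff :: "('a::real_inner \<Rightarrow> ereal) \<Rightarrow> 'a \<Rightarrow> 'a set" where
  "frechet_subdiff J x =
     {u. J x < \<infinity> \<and>
         Liminf (at x) (\<lambda>y. (J y - J x - ereal (u \<bullet> (y - x))) / ereal (norm (y - x))) \<ge> 0}"

text \<open>Like the Frechet subdifferential, the limiting subdifferential is taken to be empty
  outside the effective domain of \<open>J\<close>.\<close>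

definition subdiff :: "('a::real_inner \<Rightarrow> ereal) \<Rightarrow> 'a \<Rightarrow> 'a set" where
  "subdiff J x =
     {u. J x < \<infinity> \<and>
         (\<exists>X U. X \<longlonglongrightarrow> x \<and> (\<lambda>k. J (X k)) \<longlonglongrightarrow> J x \<and>
                (\<forall>k. U k \<in> frechet_subdiff J (X k)) \<and> U \<longlonglongrightarrow> u)}"

text \<open>The distance from the origin, with value \<open>\<infinity>\<close> on the empty set
  (the library's \<open>infdist\<close> is real-valued and gives \<open>0\<close> there).\<close>

definition dist_zero :: "'a::real_normed_vector set \<Rightarrow> ereal" where
  "dist_zero S = (INF s\<in>S. ereal (norm s))"


section \<open>The Kurdyka-Lojasiewicz property\<close>

definition KL_at :: "('a::real_inner \<Rightarrow> ereal) \<Rightarrow> 'a \<Rightarrow> bool" where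
  "KL_at J xbar \<longleftrightarrow>
     (\<exists>(\<zeta>::ereal) U (\<phi>::real \<Rightarrow> real) (\<phi>'::real \<Rightarrow> real).
        0 < \<zeta> \<and> xbar \<in> interior U \<and>
        continuous_on {s. 0 \<le> s \<and> ereal s < \<zeta>} \<phi> \<and>
        (\<forall>s. 0 \<le> s \<and> ereal s < \<zeta> \<longrightarrow> 0 \<le> \<phi> s) \<and>
        \<phi> 0 = 0 \<and>
        (\<forall>s. 0 < s \<and> ereal s < \<zeta> \<longrightarrow> (\<phi> has_real_derivative \<phi>' s) (at s)) \<and>
        continuous_on {s. 0 < s \<and> ereal s < \<zeta>} \<phi>' \<and>
        (\<forall>s. 0 < s \<and> ereal s < \<zeta> \<longrightarrow> 0 < \<phi>' s) \<and>
        (\<forall>x\<in>U. J xbar < J x \<and> J x < J xbar + \<zeta> \<longrightarrow>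
           ereal (\<phi>' (real_of_ereal (J x - J xbar))) * dist_zero (subdiff J x) \<ge> 1))"

definition KL_function :: "('a::real_inner \<Rightarrow> ereal) \<Rightarrow> bool" where
  "KL_function J \<longleftrightarrow>
     proper_fun J \<and> lower_semicont J \<and> (\<forall>x. subdiff J x \<noteq> {} \<longrightarrow> KL_at J x)"


section \<open>A basic algorithm with line search\<close>

text \<open>A basic algorithm is a set-valued map \<open>B\<close>: \<open>B x\<close> is the set of points that one step
  may generate from \<open>x\<close>.

  In \<open>line_search_exponent\<close>, the infimum in \<open>enat\<close> is the least element of a nonempty set of
  exponents, and \<open>\<infinity>\<close> if no exponent is admissible.\<close>

definition line_search_exponent ::
  "('a::real_normed_vector \<Rightarrow> real) \<Rightarrow> real \<Rightarrow> real \<Rightarrow> 'a \<Rightarrow> 'a \<Rightarrow> enat" where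
  "line_search_exponent \<Phi> \<alpha> \<eta> y d =
     (INF m\<in>{m::nat. 1 \<le> m \<and> \<Phi> (y + \<eta> ^ m *\<^sub>R d) \<le> \<Phi> y - \<alpha> * \<eta> ^ m * (norm d)\<^sup>2}. enat m)"

definition line_search_step ::
  "('a::real_normed_vector \<Rightarrow> real) \<Rightarrow> real \<Rightarrow> real \<Rightarrow> nat \<Rightarrow> 'a \<Rightarrow> 'a \<Rightarrow> real" where
  "line_search_step \<Phi> \<alpha> \<eta> M y d =
     (let m = line_search_exponent \<Phi> \<alpha> \<eta> y d
      in if m \<le> enat M then \<eta> ^ the_enat m else 0)"

definition generated_with_line_search ::
  "('a::real_normed_vector \<Rightarrow> 'a set) \<Rightarrow> ('a \<Rightarrow> real) \<Rightarrow> real \<Rightarrow> real \<Rightarrow> nat \<Rightarrow> (nat \<Rightarrow> 'a) \<Rightarrow> bool"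
where
  "generated_with_line_search B \<Phi> \<alpha> \<eta> M x \<longleftrightarrow>
     (\<exists>y d. \<forall>k. y k \<in> B (x k) \<and> d k = y k - x k \<and>
        x (Suc k) = x k + (line_search_step \<Phi> \<alpha> \<eta> M (y k) (d k) + 1) *\<^sub>R d k)"

end

theory Submission
  imports Defs
begin

text \<open>Since the line search only adds to the decrease and at most doubles the step, the iterates
  satisfy \<open>\<Phi>(x\<^sup>k\<^sup>+\<^sup>1) \<le> \<Phi>(x\<^sup>k) - a \<parallel>x\<^sup>k\<^sup>+\<^sup>1 - x\<^sup>k\<parallel>\<^sup>2\<close> and
  \<open>\<parallel>\<nabla>\<Phi>(x\<^sup>k)\<parallel> \<le> b \<parallel>x\<^sup>k\<^sup>+\<^sup>1 - x\<^sup>k\<parallel>\<close>. Let \<open>x\<^sup>*\<close> be a cluster point, with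
  desingularizing function \<open>\<phi>\<close>. Near \<open>x\<^sup>*\<close> the Kurdyka-Lojasiewicz inequality makes the potential
  \<open>\<parallel>x\<^sup>k - x\<^sup>*\<parallel> + C \<phi>(\<Phi>(x\<^sup>k) - \<Phi>(x\<^sup>*))\<close> nonincreasing; it is small along a
  subsequence, so it tends to zero along the whole sequence.\<close>

section \<open>The line search\<close>

text \<open>A step length of zero, whether from a missing exponent or from one above
  \<open>M\<close>, satisfies the inequality trivially. Otherwise the infimum of exponents is
  attained, so the accepted power of \<open>\<eta>\<close> passes the test itself.\<close>

lemma line_search_step_sufficient_decrease:
  fixes \<Phi> :: "'a::real_normed_vector \<Rightarrow> real" and \<alpha> \<eta> :: real and M :: nat and y d :: 'a
  assumes "0 < \<eta>" "\<eta> < 1"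
  defines "s \<equiv> line_search_step \<Phi> \<alpha> \<eta> M y d"
  shows "0 \<le> s" "s \<le> 1" "\<Phi> (y + s *\<^sub>R d) \<le> \<Phi> y - \<alpha> * s * (norm d)\<^sup>2"
proof -
  let ?A = "{m::nat. 1 \<le> m \<and> \<Phi> (y + \<eta> ^ m *\<^sub>R d) \<le> \<Phi> y - \<alpha> * \<eta> ^ m * (norm d)\<^sup>2}"
  have "s = 0 \<or> (\<exists>m\<in>?A. s = \<eta> ^ m)"
  proof (cases "line_search_exponent \<Phi> \<alpha> \<eta> y d \<le> enat M")
    case True
    \<comment> \<open>The infimum of the empty set is \<open>\<infinity>\<close>, so a bound by the
      finite \<open>M\<close> forces an admissible exponent to exist.\<close>
    then have "enat ` ?A \<noteq> {}"
      unfolding line_search_exponent_def by (metis Inf_enat_def infinity_ileE)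
    then have "line_search_exponent \<Phi> \<alpha> \<eta> y d \<in> enat ` ?A"
      unfolding line_search_exponent_def Inf_enat_def by (auto intro: LeastI)
    then show ?thesis
      using True by (auto simp: s_def line_search_step_def)
  qed (simp add: s_def line_search_step_def)
  then show "0 \<le> s" "s \<le> 1" "\<Phi> (y + s *\<^sub>R d) \<le> \<Phi> y - \<alpha> * s * (norm d)\<^sup>2"
    using assms(1,2) by (auto simp: power_le_one)
qed

section \<open>Subdifferentials of differentiable functions\<close>

text \<open>The difference quotient for \<open>g\<close> tends to 0. Replacing \<open>g\<close> by
  another \<open>u\<close> subtracts the component of \<open>u - g\<close> along the direction of
  approach, so approaching along \<open>u - g\<close> itself keeps the quotient near
  \<open>- norm (u - g)\<close>, below zero.\<close>

lemma frechet_subdiff_GDERIV: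
  fixes \<Phi> :: "'a::real_inner \<Rightarrow> real"
  assumes "GDERIV \<Phi> x :> g"
  shows "frechet_subdiff (\<lambda>w. ereal (\<Phi> w)) x = {g}"
proof -
  define q where "q u y = (\<Phi> y - \<Phi> x - u \<bullet> (y - x)) / norm (y - x)" for u y
  have frechet: "frechet_subdiff (\<lambda>w. ereal (\<Phi> w)) x = {u. 0 \<le> Liminf (at x) (\<lambda>y. ereal (q u y))}"
  proof -
    have "\<forall>\<^sub>F y in at x. (ereal (\<Phi> y) - ereal (\<Phi> x) - ereal (u \<bullet> (y - x))) / ereal (norm (y - x))
        = ereal (q u y)" for u
      by (auto simp: eventually_at_filter q_def)
    then have "Liminf (at x) (\<lambda>y. (ereal (\<Phi> y) - ereal (\<Phi> x) - ereal (u \<bullet> (y - x))) / ereal (norm (y - x)))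
        = Liminf (at x) (\<lambda>y. ereal (q u y))" for u
      by (rule Liminf_eq)
    then show ?thesis
      by (simp add: frechet_subdiff_def)
  qed
  have q_g: "(q g \<longlongrightarrow> 0) (at x)"
    using assms unfolding gderiv_def has_derivative_at_within has_derivative_within q_def
    by (simp add: inner_commute divide_inverse mult.commute)
  have "u = g" if u: "0 \<le> Liminf (at x) (\<lambda>y. ereal (q u y))" for u
  proof (rule ccontr)
    assume "u \<noteq> g"
    define v where "v = u - g"
    \<comment> \<open>With half the norm, the two eventual bounds give a difference of quotients
      strictly above \<open>- norm v\<close>, whereas along \<open>v\<close> it equals
      \<open>- norm v\<close>.\<close>
    define \<epsilon> where "\<epsilon> = norm v / 2"
    have "\<epsilon> > 0" using \<open>u \<noteq> g\<close> by (simp add: \<epsilon>_def v_def)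
    have "ereal (- \<epsilon>) < Liminf (at x) (\<lambda>y. ereal (q u y))"
      using u \<open>\<epsilon> > 0\<close> by (auto intro: less_le_trans[OF _ u])
    then have "\<forall>\<^sub>F y in at x. - \<epsilon> < q u y"
      using less_LiminfD by fastforce
    moreover have "\<forall>\<^sub>F y in at x. q g y < \<epsilon>"
      using q_g \<open>\<epsilon> > 0\<close> by (rule order_tendstoD)
    ultimately have "\<forall>\<^sub>F y in at x. - \<epsilon> < q u y \<and> q g y < \<epsilon>"
      by eventually_elim simp
    then obtain e where "e > 0"
      and e: "\<And>y. y \<noteq> x \<Longrightarrow> dist y x < e \<Longrightarrow> - \<epsilon> < q u y \<and> q g y < \<epsilon>"
      by (auto simp: eventually_at)
    \<comment> \<open>Puts \<open>y\<close> at distance \<open>e / 2\<close> from \<open>x\<close>,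
      within the range of the eventual bounds.\<close>
    define t where "t = e / (2 * norm v)"
    have v: "norm v > 0" using \<open>u \<noteq> g\<close> by (simp add: v_def)
    have t: "t > 0" using \<open>e > 0\<close> v by (simp add: t_def)
    define y where "y = x + t *\<^sub>R v"
    have yx: "y - x = t *\<^sub>R v" "y \<noteq> x" using t v by (auto simp: y_def)
    have "norm (y - x) = t * norm v" using yx t by simp
    also have "\<dots> = e / 2" using v by (simp add: t_def)
    finally have "dist y x < e" using \<open>e > 0\<close> by (simp add: dist_norm)
    with e yx have *: "- \<epsilon> < q u y" "q g y < \<epsilon>" by auto
    have "q u y - q g y = - (v \<bullet> (y - x)) / norm (y - x)"
      by (simp add: q_def v_def diff_divide_distrib inner_diff_left add_divide_distrib)
    also have "\<dots> = - norm v"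
      using t v by (simp add: yx power2_norm_eq_inner[symmetric] power2_eq_square)
    finally show False using * by (simp add: \<epsilon>_def)
  qed
  moreover have "0 \<le> Liminf (at x) (\<lambda>y. ereal (q g y))"
    unfolding le_Liminf_iff
  proof (intro allI impI)
    fix c :: ereal
    assume "c < 0"
    moreover have "((\<lambda>y. ereal (q g y)) \<longlongrightarrow> 0) (at x)"
      using q_g by (simp add: zero_ereal_def)
    ultimately show "\<forall>\<^sub>F y in at x. c < ereal (q g y)"
      by (rule order_tendstoD(1)[rotated])
  qed
  ultimately show ?thesis unfolding frechet by blast
qed

text \<open>Continuity of the gradient leaves only one possible limit of nearby gradients; constant
  sequences show that it is attained.\<close>

lemma subdiff_GDERIV:
  fixes \<Phi> :: "'a::real_inner \<Rightarrow> real"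
  assumes gradient: "\<And>z. GDERIV \<Phi> z :> g z" and "continuous_on UNIV g"
  shows "subdiff (\<lambda>w. ereal (\<Phi> w)) x = {g x}"
proof (intro equalityI subsetI)
  fix u
  assume "u \<in> subdiff (\<lambda>w. ereal (\<Phi> w)) x"
  then obtain X U where "X \<longlonglongrightarrow> x" "U \<longlonglongrightarrow> u" and U: "\<And>k. U k = g (X k)"
    by (auto simp: subdiff_def frechet_subdiff_GDERIV[OF gradient])
  moreover have "(\<lambda>k. g (X k)) \<longlonglongrightarrow> g x"
    by (rule continuous_on_tendsto_compose[OF assms(2) \<open>X \<longlonglongrightarrow> x\<close>]) auto
  ultimately show "u \<in> {g x}"
    using LIMSEQ_unique by (auto simp: U[abs_def])
next
  fix u
  assume "u \<in> {g x}"
  then show "u \<in> subdiff (\<lambda>w. ereal (\<Phi> w)) x"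
    unfolding subdiff_def frechet_subdiff_GDERIV[OF gradient]
    by (intro CollectI conjI exI[of _ "\<lambda>_. x"] exI[of _ "\<lambda>_. u"]) auto
qed

lemma dist_zero_singleton [simp]: "dist_zero {u} = ereal (norm u)"
  by (simp add: dist_zero_def)

section \<open>The Kurdyka-Lojasiewicz inequality for gradients\<close>

text \<open>Passes from extended reals to reals: \<open>\<zeta>\<close> shrinks to a finite number
  and the neighborhood to a ball, whose convexity later keeps whole segments inside.\<close>

lemma KL_at_GDERIV:
  fixes \<Phi> :: "'a::real_inner \<Rightarrow> real"
  assumes "KL_at (\<lambda>w. ereal (\<Phi> w)) xbar"
    and gradient: "\<And>z. GDERIV \<Phi> z :> g z" and "continuous_on UNIV g"
  obtains \<zeta> r :: real and \<phi> \<phi>' :: "real \<Rightarrow> real" where "\<zeta> > 0" "r > 0"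
    "continuous_on {0..<\<zeta>} \<phi>" "\<phi> 0 = 0" "\<And>s. 0 \<le> s \<Longrightarrow> s < \<zeta> \<Longrightarrow> 0 \<le> \<phi> s"
    "\<And>s. 0 < s \<Longrightarrow> s < \<zeta> \<Longrightarrow> (\<phi> has_real_derivative \<phi>' s) (at s)"
    "\<And>s. 0 < s \<Longrightarrow> s < \<zeta> \<Longrightarrow> 0 < \<phi>' s"
    "\<And>p. p \<in> ball xbar r \<Longrightarrow> \<Phi> xbar < \<Phi> p \<Longrightarrow> \<Phi> p < \<Phi> xbar + \<zeta> \<Longrightarrow>
      1 \<le> \<phi>' (\<Phi> p - \<Phi> xbar) * norm (g p)"
proof -
  obtain \<zeta>' :: ereal and U and \<phi> \<phi>' :: "real \<Rightarrow> real" where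
    "0 < \<zeta>'" and U: "xbar \<in> interior U" and
    cont: "continuous_on {s. 0 \<le> s \<and> ereal s < \<zeta>'} \<phi>" and
    nonneg: "\<forall>s. 0 \<le> s \<and> ereal s < \<zeta>' \<longrightarrow> 0 \<le> \<phi> s" and
    zero: "\<phi> 0 = 0" and
    deriv: "\<forall>s. 0 < s \<and> ereal s < \<zeta>' \<longrightarrow> (\<phi> has_real_derivative \<phi>' s) (at s)" and
    pos: "\<forall>s. 0 < s \<and> ereal s < \<zeta>' \<longrightarrow> 0 < \<phi>' s" and
    KL: "\<forall>p\<in>U. ereal (\<Phi> xbar) < ereal (\<Phi> p) \<and> ereal (\<Phi> p) < ereal (\<Phi> xbar) + \<zeta>' \<longrightarrow>
      1 \<le> ereal (\<phi>' (real_of_ereal (ereal (\<Phi> p) - ereal (\<Phi> xbar)))) *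
        dist_zero (subdiff (\<lambda>w. ereal (\<Phi> w)) p)"
    using assms(1) unfolding KL_at_def by (elim exE conjE) (rule that; assumption)
  obtain \<zeta> :: real where \<zeta>: "0 < \<zeta>" "ereal \<zeta> \<le> \<zeta>'"
    using ereal_dense2[OF \<open>0 < \<zeta>'\<close>] by (auto intro: less_imp_le)
  have less: "ereal s < \<zeta>'" if "s < \<zeta>" for s
    using less_le_trans[OF _ \<zeta>(2)] that by simp
  obtain r where r: "r > 0" "ball xbar r \<subseteq> U"
    using U by (auto simp: mem_interior)
  show ?thesis
  proof (rule that[of \<zeta> r \<phi> \<phi>'])
    show "continuous_on {0..<\<zeta>} \<phi>"
      using cont by (rule continuous_on_subset) (auto simp: less)
    show "1 \<le> \<phi>' (\<Phi> p - \<Phi> xbar) * norm (g p)"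
      if "p \<in> ball xbar r" "\<Phi> xbar < \<Phi> p" "\<Phi> p < \<Phi> xbar + \<zeta>" for p
    proof -
      have "ereal (\<Phi> p) < ereal (\<Phi> xbar) + \<zeta>'"
        using less[of "\<Phi> p - \<Phi> xbar"] that(3) by (cases \<zeta>') auto
      then show ?thesis
        using bspec[OF KL, of p] that r(2)
        by (simp add: subsetD subdiff_GDERIV[OF assms(2,3)] one_ereal_def)
    qed
  qed (use \<zeta>(1) r(1) nonneg zero deriv pos less in blast)+
qed

text \<open>The desingularizing function is not assumed to be concave, so its slope at the starting
  value alone says nothing about the decrease. Instead the segment from \<open>z\<close> to \<open>w\<close> attains every
  intermediate value of \<open>\<Phi>\<close>, which bounds the slope on the whole interval.\<close>

lemma desingularized_decrease:
  fixes \<Phi> :: "'a::real_normed_vector \<Rightarrow> real"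
  assumes "continuous_on (closed_segment z w) \<Phi>"
    and "c \<le> \<Phi> w" "\<Phi> w < \<Phi> z" "\<Phi> z < c + \<zeta>"
    and cont: "continuous_on {0..<\<zeta>} \<phi>"
    and deriv: "\<And>s. 0 < s \<Longrightarrow> s < \<zeta> \<Longrightarrow> (\<phi> has_real_derivative \<phi>' s) (at s)"
    and slope: "\<And>p. p \<in> closed_segment z w \<Longrightarrow> c < \<Phi> p \<Longrightarrow> \<Phi> p < c + \<zeta> \<Longrightarrow> K \<le> \<phi>' (\<Phi> p - c)"
  shows "K * (\<Phi> z - \<Phi> w) \<le> \<phi> (\<Phi> z - c) - \<phi> (\<Phi> w - c)"
proof -
  have "continuous_on {\<Phi> w - c..\<Phi> z - c} \<phi>"
    using cont by (rule continuous_on_subset) (use assms in auto)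
  moreover have "\<phi> differentiable (at s)" if "\<Phi> w - c < s" "s < \<Phi> z - c" for s
    using deriv[of s] that assms(2,4) by (auto simp: real_differentiable_def intro!: exI[of _ "\<phi>' s"])
  ultimately obtain l s where s: "\<Phi> w - c < s" "s < \<Phi> z - c" and
    l: "(\<phi> has_real_derivative l) (at s)" and
    eq: "\<phi> (\<Phi> z - c) - \<phi> (\<Phi> w - c) = (\<Phi> z - c - (\<Phi> w - c)) * l"
    using MVT[of "\<Phi> w - c" "\<Phi> z - c" \<phi>] \<open>\<Phi> w < \<Phi> z\<close> by auto
  have "connected (\<Phi> ` closed_segment z w)"
    using assms(1) by (intro connected_continuous_image) auto
  then have "{\<Phi> w<..<\<Phi> z} \<subseteq> \<Phi> ` closed_segment z w"
    by (rule connected_contains_Ioo) auto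
  moreover have "s + c \<in> {\<Phi> w<..<\<Phi> z}"
    using s by auto
  ultimately obtain p where p: "p \<in> closed_segment z w" "\<Phi> p = s + c"
    by force
  \<comment> \<open>The mean value theorem only yields some derivative at \<open>s\<close>;
    uniqueness identifies it with the prescribed one.\<close>
  have "l = \<phi>' s"
    using l deriv[of s] s assms by (intro DERIV_unique[OF l]) auto
  moreover have "K \<le> \<phi>' s"
    using slope[OF p(1)] p(2) s assms by auto
  ultimately show ?thesis
    using eq assms by (simp add: mult.commute mult_left_mono)
qed

section \<open>Convergence of descent sequences\<close>

text \<open>Separates the convergence argument from the line search. The gradient is bounded at the
  start of each step, so the drop of \<open>\<phi>\<close> over a step controls the length of that
  same step.\<close>

theorem KL_strong_descent_convergent:
  fixes \<Phi> :: "'a::{real_inner, heine_borel} \<Rightarrow> real"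
  assumes KL: "KL_function (\<lambda>w. ereal (\<Phi> w))"
    and gradient: "\<And>z. GDERIV \<Phi> z :> g z"
    and Lipschitz: "\<And>z w. norm (g z - g w) \<le> L * norm (z - w)"
    and "L \<ge> 0" "a > 0" "b > 0"
    and descent: "\<And>k. \<Phi> (x (Suc k)) \<le> \<Phi> (x k) - a * (norm (x (Suc k) - x k))\<^sup>2"
    and gradient_bound: "\<And>k. norm (g (x k)) \<le> b * norm (x (Suc k) - x k)"
    and "bounded (range x)"
  shows "\<exists>xstar. x \<longlonglongrightarrow> xstar \<and> g xstar = 0"
proof -
  have "L-lipschitz_on UNIV g"
    using Lipschitz \<open>L \<ge> 0\<close> by (auto simp: lipschitz_on_def dist_norm)
  then have g_cont: "continuous_on UNIV g"
    by (rule lipschitz_on_continuous_on)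
  have \<Phi>_cont: "continuous_on S \<Phi>" for S
    using gradient unfolding gderiv_def
    by (meson continuous_at_imp_continuous_on has_derivative_continuous)
  obtain xstar \<sigma> where \<sigma>: "strict_mono \<sigma>" and sub: "(x \<circ> \<sigma>) \<longlonglongrightarrow> xstar"
    using bounded_imp_convergent_subsequence[OF \<open>bounded (range x)\<close>] by auto
  define s where "s k = \<Phi> (x k) - \<Phi> xstar" for k
  define t where "t k = norm (x (Suc k) - x k)" for k
  have t_nonneg: "0 \<le> t k" for k by (simp add: t_def)
  have s_Suc: "s (Suc k) \<le> s k - a * (t k)\<^sup>2" for k
    using descent[of k] by (simp add: s_def t_def)
  have s_dec: "s (Suc k) \<le> s k" for k
    using s_Suc[of k] \<open>a > 0\<close> by (smt (verit) mult_nonneg_nonneg zero_le_power2)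
  then have "decseq s" by (simp add: decseq_SucI)
  have s_sub: "(s \<circ> \<sigma>) \<longlonglongrightarrow> 0"
  proof -
    have "(\<lambda>k. \<Phi> ((x \<circ> \<sigma>) k)) \<longlonglongrightarrow> \<Phi> xstar"
      by (rule continuous_on_tendsto_compose[OF \<Phi>_cont[of UNIV] sub]) auto
    then show ?thesis
      unfolding s_def o_def by (simp add: LIM_zero)
  qed
  \<comment> \<open>A decreasing sequence stays above its limit, here 0 along
    \<open>\<sigma>\<close>; and \<open>k \<le> \<sigma> k\<close> gives
    \<open>s (\<sigma> k) \<le> s k\<close>.\<close>
  have s_nonneg: "0 \<le> s k" for k
  proof -
    have "decseq (s \<circ> \<sigma>)"
      using \<open>decseq s\<close> \<sigma> by (simp add: decseq_def strict_mono_less_eq)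
    then have "0 \<le> s (\<sigma> k)"
      using decseq_ge[OF _ s_sub] by simp
    also have "\<dots> \<le> s k"
      using \<open>decseq s\<close> seq_suble[OF \<sigma>] by (simp add: decseq_def)
    finally show ?thesis .
  qed
  have s_lim: "s \<longlonglongrightarrow> 0"
  proof -
    obtain l where "s \<longlonglongrightarrow> l"
      using decseq_convergent[OF \<open>decseq s\<close>] s_nonneg by metis
    then show ?thesis
      using LIMSEQ_subseq_LIMSEQ[OF _ \<sigma>] s_sub LIMSEQ_unique by metis
  qed
  have t_lim: "t \<longlonglongrightarrow> 0"
  proof -
    have "(\<lambda>k. (s k - s (Suc k)) / a) \<longlonglongrightarrow> 0"
      using tendsto_divide[OF tendsto_diff[OF s_lim LIMSEQ_Suc[OF s_lim]] tendsto_const[of a]] \<open>a > 0\<close>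
      by simp
    moreover have "(t k)\<^sup>2 \<le> (s k - s (Suc k)) / a" for k
      using s_Suc[of k] \<open>a > 0\<close> by (simp add: field_simps)
    ultimately have "(\<lambda>k. (t k)\<^sup>2) \<longlonglongrightarrow> 0"
      by (intro tendsto_sandwich[of "\<lambda>_. 0" "\<lambda>k. (t k)\<^sup>2"]) auto
    then show ?thesis by simp
  qed
  have "KL_at (\<lambda>w. ereal (\<Phi> w)) xstar"
    using KL subdiff_GDERIV[OF gradient g_cont] by (simp add: KL_function_def)
  then obtain \<zeta> r :: real and \<phi> \<phi>' :: "real \<Rightarrow> real" where "\<zeta> > 0" "r > 0"
    and cont: "continuous_on {0..<\<zeta>} \<phi>" and "\<phi> 0 = 0"
    and nonneg: "\<And>s. 0 \<le> s \<Longrightarrow> s < \<zeta> \<Longrightarrow> 0 \<le> \<phi> s"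
    and deriv: "\<And>s. 0 < s \<Longrightarrow> s < \<zeta> \<Longrightarrow> (\<phi> has_real_derivative \<phi>' s) (at s)"
    and pos: "\<And>s. 0 < s \<Longrightarrow> s < \<zeta> \<Longrightarrow> 0 < \<phi>' s"
    and ineq: "\<And>p. p \<in> ball xstar r \<Longrightarrow> \<Phi> xstar < \<Phi> p \<Longrightarrow> \<Phi> p < \<Phi> xstar + \<zeta> \<Longrightarrow>
      1 \<le> \<phi>' (\<Phi> p - \<Phi> xstar) * norm (g p)"
    using gradient g_cont by (rule KL_at_GDERIV) (rule that)
  \<comment> \<open>A step decreases \<open>\<Phi>\<close> by at least
    \<open>a * (t k)\<^sup>2\<close>, and the slope of \<open>\<phi>\<close> is at least
    \<open>1 / ((b + L) * t k)\<close> there. So \<open>\<phi>\<close> drops by at least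
    \<open>t k / C\<close>.\<close>
  define C where "C = (b + L) / a"
  have "C > 0" using assms by (simp add: C_def)
  define V where "V k = dist (x k) xstar + C * \<phi> (s k)" for k
  \<comment> \<open>The two bounds by \<open>r / 2\<close> place both ends of the step, hence its
    segment, in the ball where the inequality holds.\<close>
  have V_Suc: "V (Suc k) \<le> V k" if "s k < \<zeta>" "V k < r / 2" "t k < r / 2" for k
  \<comment> \<open>A vanishing step is treated apart: the slope bound divides by
    \<open>t k\<close>, and the decrease of \<open>\<Phi>\<close> must be strict.\<close>
  proof (cases "t k = 0")
    case True
    then have "x (Suc k) = x k" by (simp add: t_def)
    then show ?thesis by (simp add: V_def s_def)
  next
    case False
    then have "t k > 0" using t_nonneg[of k] by simp
    have "s (Suc k) < s k"
      using s_Suc[of k] \<open>t k > 0\<close> \<open>a > 0\<close> by (smt (verit) mult_pos_pos zero_less_power)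
    have "0 \<le> \<phi> (s k)"
      using nonneg s_nonneg that by blast
    then have "dist (x k) xstar < r / 2"
      using that \<open>C > 0\<close> unfolding V_def by (smt (verit) mult_nonneg_nonneg)
    moreover have "dist (x (Suc k)) (x k) < r / 2"
      using that by (simp add: t_def dist_norm)
    ultimately have "x k \<in> ball xstar r" "x (Suc k) \<in> ball xstar r"
      using dist_triangle[of "x (Suc k)" xstar "x k"] \<open>r > 0\<close> by (auto simp: dist_commute)
    then have seg: "closed_segment (x k) (x (Suc k)) \<subseteq> ball xstar r"
      by (simp add: closed_segment_subset)
    have "1 / ((b + L) * t k) * (\<Phi> (x k) - \<Phi> (x (Suc k))) \<le>
        \<phi> (\<Phi> (x k) - \<Phi> xstar) - \<phi> (\<Phi> (x (Suc k)) - \<Phi> xstar)"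
    proof (rule desingularized_decrease[OF \<Phi>_cont _ _ _ cont deriv])
      fix p
      assume p: "p \<in> closed_segment (x k) (x (Suc k))" "\<Phi> xstar < \<Phi> p" "\<Phi> p < \<Phi> xstar + \<zeta>"
      \<comment> \<open>The gradient at \<open>p\<close> is compared with the one at
        \<open>x k\<close>: the Lipschitz condition costs \<open>L * t k\<close>, the gradient bound
        \<open>b * t k\<close>.\<close>
      have "norm (p - x k) \<le> t k"
        using segment_bound1[OF p(1)] by (simp add: t_def)
      then have "norm (g p - g (x k)) \<le> L * t k"
        using Lipschitz[of p "x k"] \<open>L \<ge> 0\<close> by (meson mult_left_mono order_trans)
      moreover have "norm (g (x k)) \<le> b * t k"
        using gradient_bound by (simp add: t_def)
      ultimately have "norm (g p) \<le> (b + L) * t k"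
        using norm_triangle_sub[of "g p" "g (x k)"] by (simp add: algebra_simps)
      moreover have "0 < \<phi>' (\<Phi> p - \<Phi> xstar)"
        using pos p by simp
      ultimately have "\<phi>' (\<Phi> p - \<Phi> xstar) * norm (g p) \<le> \<phi>' (\<Phi> p - \<Phi> xstar) * ((b + L) * t k)"
        by (simp add: mult_left_mono)
      then have "1 \<le> \<phi>' (\<Phi> p - \<Phi> xstar) * ((b + L) * t k)"
        using ineq[of p] p seg by auto
      moreover have "0 < (b + L) * t k"
        using assms \<open>t k > 0\<close> by simp
      ultimately show "1 / ((b + L) * t k) \<le> \<phi>' (\<Phi> p - \<Phi> xstar)"
        by (simp add: divide_le_eq)
    qed (use \<open>s (Suc k) < s k\<close> s_nonneg[of "Suc k"] that in \<open>auto simp: s_def\<close>)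
    then have "1 / ((b + L) * t k) * (s k - s (Suc k)) \<le> \<phi> (s k) - \<phi> (s (Suc k))"
      by (simp add: s_def)
    moreover have "1 / ((b + L) * t k) * (a * (t k)\<^sup>2) \<le> 1 / ((b + L) * t k) * (s k - s (Suc k))"
      using s_Suc[of k] assms \<open>t k > 0\<close> by (intro mult_left_mono) auto
    moreover have "1 / ((b + L) * t k) * (a * (t k)\<^sup>2) = t k / C"
      using \<open>t k > 0\<close> by (simp add: C_def power2_eq_square)
    ultimately have "t k / C \<le> \<phi> (s k) - \<phi> (s (Suc k))"
      by linarith
    then have "t k + C * \<phi> (s (Suc k)) \<le> C * \<phi> (s k)"
      using \<open>C > 0\<close> by (simp add: field_simps)
    then show ?thesis
      using dist_triangle[of "x (Suc k)" xstar "x k"] by (simp add: V_def t_def dist_norm)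
  qed
  have V_sub: "(V \<circ> \<sigma>) \<longlonglongrightarrow> 0"
  proof -
    have "\<forall>\<^sub>F k in sequentially. (s \<circ> \<sigma>) k \<in> {0..<\<zeta>}"
      using order_tendstoD(2)[OF s_sub \<open>\<zeta> > 0\<close>] by eventually_elim (simp add: s_nonneg)
    then have "(\<lambda>k. \<phi> ((s \<circ> \<sigma>) k)) \<longlonglongrightarrow> \<phi> 0"
      using \<open>\<zeta> > 0\<close> by (intro continuous_on_tendsto_compose[OF cont s_sub]) auto
    then have "(\<lambda>k. dist ((x \<circ> \<sigma>) k) xstar + C * \<phi> ((s \<circ> \<sigma>) k)) \<longlonglongrightarrow> dist xstar xstar + C * \<phi> 0"
      using sub by (intro tendsto_intros)
    then show ?thesis
      by (simp add: V_def o_def \<open>\<phi> 0 = 0\<close>)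
  qed
  have "x \<longlonglongrightarrow> xstar"
  proof (rule metric_LIMSEQ_I)
    fix e :: real
    assume "e > 0"
    \<comment> \<open>\<open>e\<close> is the target accuracy, while \<open>r / 2\<close> keeps
      \<open>V_Suc\<close> applicable.\<close>
    define \<rho> where "\<rho> = min e (r / 2)"
    have "\<rho> > 0" using \<open>e > 0\<close> \<open>r > 0\<close> by (simp add: \<rho>_def)
    have "\<forall>\<^sub>F k in sequentially. s k < \<zeta> \<and> t k < r / 2"
      using order_tendstoD(2)[OF s_lim \<open>\<zeta> > 0\<close>] order_tendstoD(2)[OF t_lim, of "r / 2"] \<open>r > 0\<close>
      by (auto intro: eventually_conj)
    then obtain N where N: "\<And>k. k \<ge> N \<Longrightarrow> s k < \<zeta> \<and> t k < r / 2"
      by (auto simp: eventually_sequentially)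
    \<comment> \<open>One sufficiently late index of the subsequence with small potential is enough;
      \<open>k0 \<le> \<sigma> k0\<close> makes it late in the full sequence too.\<close>
    have "\<forall>\<^sub>F k in sequentially. (V \<circ> \<sigma>) k < \<rho> \<and> k \<ge> N"
      using order_tendstoD(2)[OF V_sub \<open>\<rho> > 0\<close>] eventually_ge_at_top by (rule eventually_conj)
    then obtain k0 where k0: "V (\<sigma> k0) < \<rho>" "k0 \<ge> N"
      by (auto simp: eventually_sequentially)
    have "\<sigma> k0 \<ge> N"
      using k0 seq_suble[OF \<sigma>, of k0] by simp
    \<comment> \<open>\<open>V\<close> is nonincreasing only while it is small, so the induction
      carries the smallness that licenses its next step.\<close>
    have V: "V k < \<rho>" if "k \<ge> \<sigma> k0" for k
      using that
    proof (induction k rule: dec_induct)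
      case (step k)
      then show ?case
        using V_Suc[of k] N[of k] \<open>\<sigma> k0 \<ge> N\<close> by (simp add: \<rho>_def)
    qed (use k0 in simp)
    have "dist (x k) xstar < e" if "k \<ge> \<sigma> k0" for k
    proof -
      have "0 \<le> \<phi> (s k)"
        using nonneg s_nonneg N[of k] that \<open>\<sigma> k0 \<ge> N\<close> by simp
      then have "dist (x k) xstar \<le> V k"
        using \<open>C > 0\<close> by (simp add: V_def)
      then show ?thesis
        using V[OF that] by (simp add: \<rho>_def)
    qed
    then show "\<exists>n0. \<forall>k\<ge>n0. dist (x k) xstar < e" by blast
  qed
  moreover have "g xstar = 0"
  proof -
    have "(\<lambda>k. g (x k)) \<longlonglongrightarrow> g xstar"
      by (rule continuous_on_tendsto_compose[OF g_cont \<open>x \<longlonglongrightarrow> xstar\<close>]) auto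
    moreover have "(\<lambda>k. g (x k)) \<longlonglongrightarrow> 0"
    proof (rule Lim_null_comparison)
      show "\<forall>\<^sub>F k in sequentially. norm (g (x k)) \<le> b * t k"
        using gradient_bound by (simp add: t_def)
      show "(\<lambda>k. b * t k) \<longlonglongrightarrow> 0"
        using t_lim by (rule tendsto_mult_right_zero)
    qed
    ultimately show ?thesis by (rule LIMSEQ_unique)
  qed
  ultimately show ?thesis by blast
qed

section \<open>The algorithm with line search as a descent method\<close>

theorem theorem3p5:
  fixes \<Phi> :: "real ^ 'n \<Rightarrow> real"
    and grad\<Phi> :: "real ^ 'n \<Rightarrow> real ^ 'n"
    and B :: "real ^ 'n \<Rightarrow> (real ^ 'n) set"
    and x :: "nat \<Rightarrow> real ^ 'n"
    and \<alpha> \<eta> \<nu> \<beta> L :: real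
    and M :: nat
  assumes inf_\<Phi>: "(INF z. ereal (\<Phi> z)) > -\<infinity>"
    and "\<nu> > 0" and "\<beta> > 0"
    and B_descent: "\<And>z y. y \<in> B z \<Longrightarrow> \<Phi> y \<le> \<Phi> z - \<nu> * (norm (y - z))\<^sup>2"
    and B_subdiff: "\<And>z y. y \<in> B z \<Longrightarrow>
          dist_zero (subdiff (\<lambda>w. ereal (\<Phi> w)) y) \<le> ereal (\<beta> * norm (y - z))"
    and KL: "KL_function (\<lambda>w. ereal (\<Phi> w))"
    and "L \<ge> 0"
    and gradient: "\<And>z. GDERIV \<Phi> z :> grad\<Phi> z"
    and gradient_Lipschitz: "\<And>z w. norm (grad\<Phi> z - grad\<Phi> w) \<le> L * norm (z - w)"
    and "\<alpha> > 0" and "0 < \<eta>" and "\<eta> < 1"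
    and generated: "generated_with_line_search B \<Phi> \<alpha> \<eta> M x"
    and bounded_x: "bounded (range x)"
  shows "\<exists>xstar. x \<longlonglongrightarrow> xstar \<and> 0 \<in> subdiff (\<lambda>w. ereal (\<Phi> w)) xstar"
proof -
  have "L-lipschitz_on UNIV grad\<Phi>"
    using gradient_Lipschitz \<open>L \<ge> 0\<close> by (auto simp: lipschitz_on_def dist_norm)
  then have "continuous_on UNIV grad\<Phi>"
    by (rule lipschitz_on_continuous_on)
  note subdiff = subdiff_GDERIV[OF gradient this]
  obtain y d where y: "\<And>k. y k \<in> B (x k)" and d: "\<And>k. d k = y k - x k"
    and x_Suc: "\<And>k. x (Suc k) = x k + (line_search_step \<Phi> \<alpha> \<eta> M (y k) (d k) + 1) *\<^sub>R d k"
    using generated unfolding generated_with_line_search_def by blast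
  define s where "s k = line_search_step \<Phi> \<alpha> \<eta> M (y k) (d k)" for k
  note s = line_search_step_sufficient_decrease[OF \<open>0 < \<eta>\<close> \<open>\<eta> < 1\<close>, 
      where \<Phi> = \<Phi> and \<alpha> = \<alpha> and M = M and y = "y k" and d = "d k" for k,
      folded s_def]
  have step: "norm (x (Suc k) - x k) = (1 + s k) * norm (d k)" for k
    using s(1)[of k] by (simp add: x_Suc s_def[symmetric] add.commute)
  \<comment> \<open>Since \<open>s k \<le> 1\<close>, the full step is at most twice
    \<open>d k\<close>; squaring this factor turns \<open>\<nu>\<close> into
    \<open>\<nu> / 4\<close>.\<close>
  have "\<Phi> (x (Suc k)) \<le> \<Phi> (x k) - \<nu> / 4 * (norm (x (Suc k) - x k))\<^sup>2" for k
  proof -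
    have "x (Suc k) = y k + s k *\<^sub>R d k"
      using x_Suc[of k] by (simp add: d s_def algebra_simps)
    then have "\<Phi> (x (Suc k)) \<le> \<Phi> (y k) - \<alpha> * s k * (norm (d k))\<^sup>2"
      using s(3) by simp
    also have "\<dots> \<le> \<Phi> (y k)"
      using s(1) \<open>\<alpha> > 0\<close> by simp
    also have "\<dots> \<le> \<Phi> (x k) - \<nu> * (norm (d k))\<^sup>2"
      using B_descent[OF y] by (simp add: d)
    also have "\<dots> \<le> \<Phi> (x k) - \<nu> / 4 * (norm (x (Suc k) - x k))\<^sup>2"
    proof -
      have "(norm (x (Suc k) - x k))\<^sup>2 \<le> (2 * norm (d k))\<^sup>2"
        unfolding step using s(1,2)[of k] by (intro power_mono mult_right_mono) auto
      then show ?thesis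
        using \<open>\<nu> > 0\<close> by (simp add: power_mult_distrib)
    qed
    finally show ?thesis .
  qed
  \<comment> \<open>Algorithm B controls the gradient at \<open>y k\<close>; the Lipschitz condition
    carries this back to \<open>x k\<close> at cost \<open>L * norm (d k)\<close>. Then
    \<open>s k \<ge> 0\<close> bounds \<open>norm (d k)\<close> by the full step.\<close>
  moreover have "norm (grad\<Phi> (x k)) \<le> (\<beta> + L) * norm (x (Suc k) - x k)" for k
  proof -
    have "norm (grad\<Phi> (y k)) \<le> \<beta> * norm (d k)"
      using B_subdiff[OF y] by (simp add: subdiff d)
    moreover have "norm (grad\<Phi> (x k) - grad\<Phi> (y k)) \<le> L * norm (d k)"
      using gradient_Lipschitz[of "x k" "y k"] by (simp add: d norm_minus_commute)
    ultimately have "norm (grad\<Phi> (x k)) \<le> (\<beta> + L) * norm (d k)"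
      using norm_triangle_sub[of "grad\<Phi> (x k)" "grad\<Phi> (y k)"] by (simp add: algebra_simps)
    also have "\<dots> \<le> (\<beta> + L) * norm (x (Suc k) - x k)"
      using s(1)[of k] \<open>\<beta> > 0\<close> \<open>L \<ge> 0\<close> by (intro mult_left_mono) (auto simp: step algebra_simps)
    finally show ?thesis .
  qed
  ultimately obtain xstar where "x \<longlonglongrightarrow> xstar" "grad\<Phi> xstar = 0"
    using KL_strong_descent_convergent[OF KL gradient gradient_Lipschitz \<open>L \<ge> 0\<close>,
        of "\<nu> / 4" "\<beta> + L" x] \<open>\<nu> > 0\<close> \<open>\<beta> > 0\<close> \<open>L \<ge> 0\<close> bounded_x
    by auto
  then show ?thesis
    using subdiff by auto
qed

end
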